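(* Let $k\ge1$ be an integer and $\lambda,\delta,\gamma>0$. Let $\{N^{(k)}(t)\}_{t\ge0}$ be the Poisson process of order $k$ with parameter $\lambda$, let $\{G(t)\}_{t\ge0}$ be the inverse Gaussian subordinator with parameters $\delta,\gamma$, independent of $\{N^{(k)}(t)\}_{t\ge0}$, and let $\hat p_m(t)=\mathbb{P}[N^{(k)}(G(t))=m]$, $m=0,1,2,\ldots$. Then $$\left(\frac{d^2}{dt^2}-2\delta\gamma\frac{d}{dt}\right)\hat p_m(t)=2\delta^2\lambda\left[k\hat p_m(t)-\left(\hat p_{m-1}(t)+\hat p_{m-2}(t)+\cdots+\hat p_{m-m\wedge k}(t)\right)\right].$$
   Context: $m\wedge k=\min\{m,k\}$; the sum $\hat p_{m-1}+\cdots+\hat p_{m-m\wedge k}=\sum_{j=1}^{m\wedge k}\hat p_{m-j}$ is empty (zero) for $m=0$. Poisson process of order $k$ (PPoK) with parameter $\lambda$: $N^{(k)}(t)=\sum_{i=0}^{N(t,k\lambda)}X_i$, where $\{N(t,k\lambda)\}_{t\ge0}$ is a Poisson process of rate $k\lambda$, $X_0\equiv 0$, and $\{X_i\}_{i\ge 1}$ are IID uniform on $\{1,2,\ldots,k\}$, independent of the Poisson process. Inverse Gaussian subordinator, $G(t)\sim IG(\delta t,\gamma)$: the non-decreasing Lévy process with $\mathbb{E}[e^{-sG(t)}]=e^{-tf(s)}$, $f(s)=\delta(\sqrt{2s+\gamma^2}-\gamma)$, i.e. zero drift and Lévy measure $\nu(dx)=\frac{\delta}{\sqrt{2\pi x^3}}e^{-\gamma^2x/2}\,dx$,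 $x>0$. *)

theory Defs
  imports "HOL-Probability.Probability"
begin

text \<open>
  Time is \<^typ>\<open>real\<close>; processes are only constrained, and only used, on \<open>{0..}\<close>. Path properties are
  required for every \<open>\<omega>\<close> in the sample space rather than almost surely: \<open>M\<close> is not assumed to
  be complete, and they make \<open>\<omega> \<mapsto> N (G t \<omega>) \<omega>\<close> a random variable.
\<close>

definition process_sigma :: "'a measure \<Rightarrow> 'i set \<Rightarrow> 'b measure \<Rightarrow> ('i \<Rightarrow> 'a \<Rightarrow> 'b) \<Rightarrow> 'a set set" where
  "process_sigma M I S Y =
     sigma_sets (space M) {Y i -` A \<inter> space M | i A. i \<in> I \<and> A \<in> sets S}"

text \<open>A finite partition is the initial segment of an infinite one that is eventually constant.\<close>

definition (in prob_space) indep_increments :: "(real \<Rightarrow> 'a \<Rightarrow> real) \<Rightarrow> bool" where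
  "indep_increments Y \<longleftrightarrow>
     (\<forall>(n::nat) (\<tau> :: nat \<Rightarrow> real). 0 \<le> \<tau> 0 \<and> mono \<tau> \<longrightarrow>
        indep_vars (\<lambda>_. borel) (\<lambda>i \<omega>. Y (\<tau> (Suc i)) \<omega> - Y (\<tau> i) \<omega>) {..<n})"

text \<open>Since paths are nondecreasing, truncated subtraction on \<^typ>\<open>nat\<close> is the true increment below.
  The restriction \<open>s < t\<close> is needed because \<open>poisson_pmf\<close> is specified only for positive rates.\<close>

locale poisson_process = prob_space M for M :: "'a measure" +
  fixes N :: "real \<Rightarrow> 'a \<Rightarrow> nat" and r :: real
  assumes rv: "t \<ge> 0 \<Longrightarrow> random_variable (count_space UNIV) (N t)"
    and zero: "\<omega> \<in> space M \<Longrightarrow> N 0 \<omega> = 0"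
    and nondecreasing: "\<omega> \<in> space M \<Longrightarrow> mono_on {0..} (\<lambda>t. N t \<omega>)"
    and right_continuous: "\<omega> \<in> space M \<Longrightarrow> t \<ge> 0 \<Longrightarrow> continuous (at_right t) (\<lambda>s. N s \<omega>)"
    and indep_incs: "indep_increments (\<lambda>t \<omega>. real (N t \<omega>))"
    and poisson_incs: "0 \<le> s \<Longrightarrow> s < t \<Longrightarrow>
          distr M (count_space UNIV) (\<lambda>\<omega>. N t \<omega> - N s \<omega>) = measure_pmf (poisson_pmf (r * (t - s)))"

definition poisson_process_of_order ::
    "'a measure \<Rightarrow> nat \<Rightarrow> real \<Rightarrow> (real \<Rightarrow> 'a \<Rightarrow> nat) \<Rightarrow> bool" where
  "poisson_process_of_order M k lam Nk \<longleftrightarrow>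
     (\<exists>(N :: real \<Rightarrow> 'a \<Rightarrow> nat) (X :: nat \<Rightarrow> 'a \<Rightarrow> nat).
        poisson_process M N (real k * lam) \<and>
        (\<forall>\<omega>\<in>space M. X 0 \<omega> = 0) \<and>
        prob_space.indep_vars M (\<lambda>_. count_space UNIV) X {1..} \<and>
        (\<forall>i\<ge>1. distr M (count_space UNIV) (X i) = measure_pmf (pmf_of_set {1..k})) \<and>
        prob_space.indep_set M
          (process_sigma M {0..} (count_space UNIV) N)
          (process_sigma M {1..} (count_space UNIV) X) \<and>
        (\<forall>t\<ge>0. \<forall>\<omega>\<in>space M. Nk t \<omega> = (\<Sum>i=0..N t \<omega>. X i \<omega>)))"

locale levy_process = prob_space M for M :: "'a measure" +
  fixes Y :: "real \<Rightarrow> 'a \<Rightarrow> real"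
  assumes rv: "t \<ge> 0 \<Longrightarrow> random_variable borel (Y t)"
    and zero: "\<omega> \<in> space M \<Longrightarrow> Y 0 \<omega> = 0"
    and right_continuous: "\<omega> \<in> space M \<Longrightarrow> t \<ge> 0 \<Longrightarrow> continuous (at_right t) (\<lambda>s. Y s \<omega>)"
    and left_limits: "\<omega> \<in> space M \<Longrightarrow> t > 0 \<Longrightarrow> \<exists>l. ((\<lambda>s. Y s \<omega>) \<longlongrightarrow> l) (at_left t)"
    and indep_incs: "indep_increments Y"
    and stationary_incs: "0 \<le> s \<Longrightarrow> s \<le> t \<Longrightarrow>
          distr M borel (\<lambda>\<omega>. Y t \<omega> - Y s \<omega>) = distr M borel (Y (t - s))"

locale inverse_gaussian_subordinator = levy_process M G
  for M :: "'a measure" and G :: "real \<Rightarrow> 'a \<Rightarrow> real" +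
  fixes \<delta> \<gamma> :: real
  assumes nondecreasing: "\<omega> \<in> space M \<Longrightarrow> mono_on {0..} (\<lambda>t. G t \<omega>)"
    and laplace_transform: "t \<ge> 0 \<Longrightarrow> s \<ge> 0 \<Longrightarrow>
          expectation (\<lambda>\<omega>. exp (- s * G t \<omega>)) = exp (- t * (\<delta> * (sqrt (2 * s + \<gamma>\<^sup>2) - \<gamma>)))"

definition p_hat :: "'a measure \<Rightarrow> (real \<Rightarrow> 'a \<Rightarrow> nat) \<Rightarrow> (real \<Rightarrow> 'a \<Rightarrow> real) \<Rightarrow> nat \<Rightarrow> real \<Rightarrow> real" where
  "p_hat M Nk G m t = measure M {\<omega> \<in> space M. Nk (G t \<omega>) \<omega> = m}"

end

theory Submission
  imports Defs
begin

text \<open>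
  Conditioning on the subordinator turns \<open>p_hat\<close> into a finite combination of the tempered moments
  \<open>\<mu>\<^sub>n(t) = E (G t ^ n * exp (- a * G t))\<close> with \<open>a = k * lam\<close>, whose coefficients are
  \<open>a ^ n / n!\<close> times the probability that \<open>n\<close> uniform jumps add up to \<open>m\<close>. The Laplace exponent satisfies
  \<open>f\<^sup>2 + 2 \<delta> \<gamma> f = 2 \<delta>\<^sup>2 s\<close>, so \<open>\<mu>\<^sub>n'' - 2 \<delta> \<gamma> \<mu>\<^sub>n' = 2 \<delta>\<^sup>2 (a \<mu>\<^sub>n - n \<mu>\<^bsub>n-1\<^esub>)\<close>; the term
  \<open>n \<mu>\<^bsub>n-1\<^esub>\<close> becomes the sum over \<open>j\<close> by conditioning on the size of the last jump.
\<close>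

section \<open>Tempered moments of the inverse Gaussian law: closed form and derivatives\<close>

text \<open>
  With \<open>r = sqrt (2 * s + \<gamma>\<^sup>2)\<close> and \<open>g = \<delta> * t\<close>, this is \<open>exp (- (\<gamma> * g))\<close> times
  \<open>\<mu>\<^sub>n = E (G t ^ n * exp (- s * G t))\<close>. The recurrence arises from differentiating \<open>n\<close> times in \<open>s\<close> the
  equation \<open>(2 * s + \<gamma>\<^sup>2) * h'' + h' = g\<^sup>2 * h\<close>, which the Laplace transform \<open>h\<close> of \<open>G t\<close> satisfies.
\<close>

fun ig_moment :: "real \<Rightarrow> nat \<Rightarrow> real \<Rightarrow> real" where
  "ig_moment r 0 g = exp (- (r * g))"
| "ig_moment r (Suc 0) g = g * exp (- (r * g)) / r"
| "ig_moment r (Suc (Suc n)) g =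
     (real (2 * n + 1) * ig_moment r (Suc n) g + g\<^sup>2 * ig_moment r n g) / r\<^sup>2"

text \<open>Since \<open>sqrt (2 * s + \<gamma>\<^sup>2)\<close> has derivative \<open>1 / r\<close>
  in \<open>s\<close>, this is the rule that minus the derivative in \<open>s\<close> raises the
  order of a tempered moment by one, written in the variable \<open>r\<close>. Differentiating the
  three-term recurrence carries it from two consecutive indices to the next.\<close>

lemma ig_moment_deriv_r:
  assumes "r > 0"
  shows "((\<lambda>r. ig_moment r n g) has_real_derivative - r * ig_moment r (Suc n) g) (at r)"
proof (induction n rule: induct_nat_012)
  case (ge2 n)
  have "((\<lambda>r. (real (2 * n + 1) * ig_moment r (Suc n) g + g\<^sup>2 * ig_moment r n g) / r\<^sup>2)
      has_real_derivative
        ((real (2 * n + 1) * (- r * ig_moment r (Suc (Suc n)) g)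
           + g\<^sup>2 * (- r * ig_moment r (Suc n) g)) * r\<^sup>2
         - (real (2 * n + 1) * ig_moment r (Suc n) g + g\<^sup>2 * ig_moment r n g) * (2 * r))
        / (r\<^sup>2 * r\<^sup>2)) (at r)"
    by (rule derivative_eq_intros ge2 refl | use assms in simp)+
  \<comment> \<open>Reading the recurrence backwards turns the contribution of the denominator
    \<open>r\<^sup>2\<close> into a multiple of \<open>ig_moment r (Suc (Suc n)) g\<close>, which
    raises the coefficient \<open>2 * n + 1\<close> to \<open>2 * n + 3\<close>.\<close>
  also have "real (2 * n + 1) * ig_moment r (Suc n) g + g\<^sup>2 * ig_moment r n g
      = r\<^sup>2 * ig_moment r (Suc (Suc n)) g"
    using assms by simp
  also have "((real (2 * n + 1) * (- r * ig_moment r (Suc (Suc n)) g)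
           + g\<^sup>2 * (- r * ig_moment r (Suc n) g)) * r\<^sup>2
         - r\<^sup>2 * ig_moment r (Suc (Suc n)) g * (2 * r)) / (r\<^sup>2 * r\<^sup>2)
      = - r * ((real (2 * Suc n + 1) * ig_moment r (Suc (Suc n)) g + g\<^sup>2 * ig_moment r (Suc n) g) / r\<^sup>2)"
    using assms by (simp add: field_simps power2_eq_square del: ig_moment.simps)
  finally show ?case
    by (simp only: ig_moment.simps)
qed (use assms in \<open>auto intro!: derivative_eq_intros simp: field_simps power2_eq_square\<close>)

text \<open>The quotient \<open>ig_moment r (Suc n) g / g\<close>, extended to \<open>g = 0\<close>.\<close>

fun ig_moment_quot :: "real \<Rightarrow> nat \<Rightarrow> real \<Rightarrow> real" where
  "ig_moment_quot r 0 g = exp (- (r * g)) / r"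
| "ig_moment_quot r (Suc 0) g = (ig_moment_quot r 0 g + g * exp (- (r * g))) / r\<^sup>2"
| "ig_moment_quot r (Suc (Suc n)) g =
     (real (2 * n + 3) * ig_moment_quot r (Suc n) g + g\<^sup>2 * ig_moment_quot r n g) / r\<^sup>2"

text \<open>The quotient obeys the recurrence of \<open>ig_moment\<close> with the index raised by
  one; hence its coefficient \<open>2 * n + 3\<close>.\<close>

lemma ig_moment_Suc: "ig_moment r (Suc n) g = g * ig_moment_quot r n g"
  by (induction n rule: induct_nat_012) (auto simp: field_simps power2_eq_square)

text \<open>For \<open>g > 0\<close> and up to a factor depending only on \<open>r\<close> and
  \<open>n\<close>, the quotient is z^\<nu> K_\<nu>(z) with z = r g, \<nu> = n + 1/2 and K the
  modified Bessel function; the rule is (z^\<nu> K_\<nu>)' = - z^\<nu> K_{\<nu>-1}. As nothing is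
  divided by \<open>g\<close>, it includes \<open>g = 0\<close>, that is,
  \<open>t = 0\<close>.\<close>

lemma ig_moment_quot_deriv:
  assumes "r > 0"
  shows "(ig_moment_quot r n has_real_derivative - ig_moment r n g) (at g)"
proof (induction n rule: induct_nat_012)
  case (ge2 n)
  have "((\<lambda>g. (real (2 * n + 3) * ig_moment_quot r (Suc n) g + g\<^sup>2 * ig_moment_quot r n g) / r\<^sup>2)
      has_real_derivative
        (real (2 * n + 3) * (- ig_moment r (Suc n) g)
           + (2 * g * ig_moment_quot r n g + g\<^sup>2 * (- ig_moment r n g))) / r\<^sup>2) (at g)"
  proof (intro DERIV_cdivide DERIV_add DERIV_cmult ge2)
    have "((\<lambda>g. g\<^sup>2) has_real_derivative 2 * g) (at g)"
      by (auto intro!: derivative_eq_intros)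
    from DERIV_mult[OF this ge2(1)]
    show "((\<lambda>g. g\<^sup>2 * ig_moment_quot r n g) has_real_derivative
        2 * g * ig_moment_quot r n g + g\<^sup>2 * - ig_moment r n g) (at g)"
      by (simp add: mult.commute)
  qed
  \<comment> \<open>The derivative of \<open>g\<^sup>2\<close> lowers the coefficient
    \<open>2 * n + 3\<close> to \<open>2 * n + 1\<close>, the one in the recurrence of
    \<open>ig_moment\<close>.\<close>
  also have "2 * g * ig_moment_quot r n g = 2 * ig_moment r (Suc n) g"
    by (simp add: ig_moment_Suc)
  also have "(real (2 * n + 3) * (- ig_moment r (Suc n) g)
      + (2 * ig_moment r (Suc n) g + g\<^sup>2 * (- ig_moment r n g))) / r\<^sup>2
      = - ig_moment r (Suc (Suc n)) g"
    by (simp add: divide_simps) (simp add: algebra_simps)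
  finally show ?case
    by (simp only: ig_moment_quot.simps)
qed (use assms in \<open>auto intro!: derivative_eq_intros simp: field_simps power2_eq_square\<close>)

text \<open>For positive index the product rule applies to \<open>g * ig_moment_quot r l g\<close>,
  and the recurrence simplifies the second derivative. The first derivative is left existential,
  since later only its own derivative matters. For \<open>n = 0\<close> the truncated
  \<open>n - 1\<close> is multiplied by zero.\<close>

lemma ig_moment_deriv_g:
  assumes "r > 0"
  shows "\<exists>D. \<forall>g. (ig_moment r n has_real_derivative D g) (at g) \<and>
    (D has_real_derivative r\<^sup>2 * ig_moment r n g - 2 * real n * ig_moment r (n - 1) g) (at g)"
proof (cases n)
  case 0
  then show ?thesis
    by (intro exI[of _ "\<lambda>g. - r * exp (- (r * g))"])
      (auto intro!: derivative_eq_intros simp: power2_eq_square ig_moment.simps(1)[abs_def])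
next
  case (Suc l)
  let ?D = "\<lambda>l g. ig_moment_quot r l g - g * ig_moment r l g"
  have 1: "(ig_moment r (Suc l) has_real_derivative ?D l g) (at g)" for l g
    using DERIV_mult[OF DERIV_ident ig_moment_quot_deriv[where n = l and g = g, OF assms]]
    by (simp add: ig_moment_Suc[abs_def] mult.commute)
  have 2: "(?D l has_real_derivative r\<^sup>2 * ig_moment r (Suc l) g - 2 * real (Suc l) * ig_moment r l g) (at g)"
    for g
  proof (cases l)
    case 0
    then show ?thesis
      using assms by (auto intro!: derivative_eq_intros simp: field_simps power2_eq_square)
  next
    case (Suc i)
    have "(?D l has_real_derivative
        - ig_moment r l g - (ig_moment r l g + g * (ig_moment_quot r i g - g * ig_moment r i g))) (at g)"
      unfolding Suc
      using DERIV_diff[OF ig_moment_quot_deriv[OF assms] DERIV_mult[OF DERIV_ident 1[where l = i]],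
          of "Suc i" g]
      by (simp add: algebra_simps del: ig_moment.simps ig_moment_quot.simps)
    \<comment> \<open>Here \<open>g * ig_moment_quot r i g\<close> is
      \<open>ig_moment r l g\<close>, and the recurrence eliminates
      \<open>g\<^sup>2 * ig_moment r i g\<close>; the coefficients add up to
      \<open>- 3 - (2 * i + 1) = - 2 * (l + 1)\<close>.\<close>
    also have "- ig_moment r l g - (ig_moment r l g + g * (ig_moment_quot r i g - g * ig_moment r i g))
        = r\<^sup>2 * ig_moment r (Suc l) g - 2 * real (Suc l) * ig_moment r l g"
      using assms ig_moment_Suc[of r i g]
      by (simp add: Suc field_simps power2_eq_square)
    finally show ?thesis .
  qed
  show ?thesis
    unfolding Suc using 1 2 by (intro exI[of _ "?D l"]) (simp del: ig_moment.simps)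
qed

section \<open>Laplace transforms and their derivatives\<close>

text \<open>A single term of the exponential series of \<open>s * x\<close> is at most
  \<open>exp (s * x)\<close>. The bound does not depend on \<open>x\<close>, so tempered moments of
  every order are finite.\<close>

lemma power_mult_exp_le:
  fixes x s :: real
  assumes "x \<ge> 0" "s > 0"
  shows "x ^ n * exp (- (s * x)) \<le> fact n / s ^ n"
proof -
  have "(s * x) ^ n / fact n = (\<Sum>i\<in>{n}. (s * x) ^ i /\<^sub>R fact i)"
    by (simp add: field_simps)
  also have "\<dots> \<le> (\<Sum>i. (s * x) ^ i /\<^sub>R fact i)"
    using assms by (intro sum_le_suminf summable_exp_generic) auto
  also have "\<dots> = exp (s * x)"
    by (simp add: exp_def)
  finally show ?thesis
    using assms by (simp add: exp_minus field_simps)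
qed

lemma (in finite_measure) integrable_power_mult_exp:
  fixes X :: "'a \<Rightarrow> real"
  assumes [measurable]: "X \<in> borel_measurable M" and "\<And>\<omega>. \<omega> \<in> space M \<Longrightarrow> X \<omega> \<ge> 0" and "s > 0"
  shows "integrable M (\<lambda>\<omega>. X \<omega> ^ n * exp (- (s * X \<omega>)))"
proof (rule integrable_const_bound[where B = "fact n / s ^ n"])
  show "AE \<omega> in M. norm (X \<omega> ^ n * exp (- (s * X \<omega>))) \<le> fact n / s ^ n"
    using assms power_mult_exp_le by (intro AE_I2) auto
qed measurable

lemma (in finite_measure) laplace_moment_deriv:
  fixes X :: "'a \<Rightarrow> real"
  assumes [measurable]: "X \<in> borel_measurable M" and nn: "\<And>\<omega>. \<omega> \<in> space M \<Longrightarrow> X \<omega> \<ge> 0" and s: "s > 0"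
  shows "((\<lambda>s. \<integral>\<omega>. X \<omega> ^ n * exp (- (s * X \<omega>)) \<partial>M) has_real_derivative
           - (\<integral>\<omega>. X \<omega> ^ Suc n * exp (- (s * X \<omega>)) \<partial>M)) (at s)"
  \<comment> \<open>No differentiation under the integral: \<open>1 + x \<le> exp x\<close> bounds the increments of each \<open>\<phi> n\<close> by \<open>\<phi> (Suc n)\<close>.\<close>
proof -
  define \<phi> where "\<phi> = (\<lambda>n s. \<integral>\<omega>. X \<omega> ^ n * exp (- (s * X \<omega>)) \<partial>M)"
  note int = integrable_power_mult_exp[of X, OF assms(1) nn]
  \<comment> \<open>Tangent line inequality: the graph of \<open>\<phi> n\<close> lies above the
    line through its point at \<open>x\<close> with slope \<open>- \<phi> (Suc n) x\<close>.\<close>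
  have upper: "(x - y) * \<phi> (Suc n) x \<le> \<phi> n y - \<phi> n x" if "x > 0" "y > 0" for n x y
  proof -
    have "(x - y) * \<phi> (Suc n) x = (\<integral>\<omega>. (x - y) * (X \<omega> ^ Suc n * exp (- (x * X \<omega>))) \<partial>M)"
      by (simp add: \<phi>_def)
    also have "\<dots> \<le> (\<integral>\<omega>. X \<omega> ^ n * exp (- (y * X \<omega>)) - X \<omega> ^ n * exp (- (x * X \<omega>)) \<partial>M)"
    proof (rule integral_mono)
      fix \<omega> assume \<omega>: "\<omega> \<in> space M"
      have "1 + (x - y) * X \<omega> \<le> exp ((x - y) * X \<omega>)"
        by (rule exp_ge_add_one_self)
      then have "(1 + (x - y) * X \<omega>) * (X \<omega> ^ n * exp (- (x * X \<omega>)))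
          \<le> exp ((x - y) * X \<omega>) * (X \<omega> ^ n * exp (- (x * X \<omega>)))"
        by (rule mult_right_mono) (use nn[OF \<omega>] in auto)
      also have "\<dots> = X \<omega> ^ n * exp (- (y * X \<omega>))"
        by (simp add: algebra_simps flip: exp_add)
      finally show "(x - y) * (X \<omega> ^ Suc n * exp (- (x * X \<omega>)))
          \<le> X \<omega> ^ n * exp (- (y * X \<omega>)) - X \<omega> ^ n * exp (- (x * X \<omega>))"
        by (simp add: algebra_simps)
    qed (use int that in \<open>auto simp del: power_Suc\<close>)
    also have "\<dots> = \<phi> n y - \<phi> n x"
      unfolding \<phi>_def by (rule Bochner_Integration.integral_diff) (use int that in auto)
    finally show ?thesis .
  qed
  have nonneg: "\<phi> n x \<ge> 0" for n x
    unfolding \<phi>_def by (rule integral_nonneg_AE) (use nn in auto)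
  have antimono: "\<phi> n y \<le> \<phi> n x" if "0 < x" "x \<le> y" for n x y
  proof -
    have "0 \<le> (y - x) * \<phi> (Suc n) y"
      using that nonneg by auto
    then show ?thesis
      using upper[of y x n] that by linarith
  qed
  have lipschitz: "\<bar>\<phi> n y - \<phi> n x\<bar> \<le> \<bar>y - x\<bar> * \<phi> (Suc n) c" if "0 < c" "c \<le> x" "c \<le> y" for n x y c
  proof (cases x y rule: linorder_cases)
    case less
    then have "(y - x) * \<phi> (Suc n) x \<le> (y - x) * \<phi> (Suc n) c"
      using that antimono[of c x "Suc n"] by (intro mult_left_mono) auto
    then show ?thesis
      using upper[of x y n] antimono[of x y n] less that by (simp add: algebra_simps)
  next
    case greater
    then have "(x - y) * \<phi> (Suc n) y \<le> (x - y) * \<phi> (Suc n) c"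
      using that antimono[of c y "Suc n"] by (intro mult_left_mono) auto
    then show ?thesis
      using upper[of y x n] antimono[of y x n] greater that by (simp add: algebra_simps)
  qed auto
  \<comment> \<open>The tangent inequalities at \<open>s\<close> and at \<open>y\<close> enclose the
    error, and the Lipschitz bound makes it quadratic. The constant is taken at
    \<open>s / 2\<close>, a positive lower bound for both points, because the estimates need
    positive arguments.\<close>
  have bound: "\<bar>\<phi> n y - \<phi> n s + (y - s) * \<phi> (Suc n) s\<bar> \<le> \<phi> (Suc (Suc n)) (s / 2) * (y - s)\<^sup>2"
    if "s / 2 < y" for y
  proof -
    have "\<phi> n y - \<phi> n s + (y - s) * \<phi> (Suc n) s \<ge> 0"
      using upper[of s y n] s that by (simp add: algebra_simps)
    moreover have "\<phi> n y - \<phi> n s + (y - s) * \<phi> (Suc n) s \<le> (y - s) * (\<phi> (Suc n) s - \<phi> (Suc n) y)"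
      using upper[of y s n] s that by (simp add: algebra_simps)
    moreover have "\<dots> \<le> \<bar>y - s\<bar> * \<bar>\<phi> (Suc n) s - \<phi> (Suc n) y\<bar>"
      by (metis abs_ge_self abs_mult)
    moreover have "\<dots> \<le> \<bar>y - s\<bar> * (\<bar>s - y\<bar> * \<phi> (Suc (Suc n)) (s / 2))"
      using lipschitz[of "s / 2" y s "Suc n"] s that by (intro mult_left_mono) auto
    moreover have "\<dots> = \<phi> (Suc (Suc n)) (s / 2) * (y - s)\<^sup>2"
      by (simp add: abs_minus_commute[of s y] power2_eq_square mult.assoc [symmetric] flip: abs_mult)
    ultimately show ?thesis
      by linarith
  qed
  have "((\<lambda>y. (\<phi> n y - \<phi> n s) / (y - s) + \<phi> (Suc n) s) \<longlongrightarrow> 0) (at s)"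
  proof (rule Lim_null_comparison)
    have "\<forall>\<^sub>F y in at s. s / 2 < y \<and> y \<noteq> s"
      using s by (intro eventually_conj order_tendstoD(1)[OF tendsto_ident_at])
        (auto simp: eventually_at_filter)
    then show "\<forall>\<^sub>F y in at s. norm ((\<phi> n y - \<phi> n s) / (y - s) + \<phi> (Suc n) s)
        \<le> \<phi> (Suc (Suc n)) (s / 2) * \<bar>y - s\<bar>"
    proof eventually_elim
      case (elim y)
      then have "norm ((\<phi> n y - \<phi> n s) / (y - s) + \<phi> (Suc n) s)
          = \<bar>\<phi> n y - \<phi> n s + (y - s) * \<phi> (Suc n) s\<bar> / \<bar>y - s\<bar>"
        by (simp add: add_divide_distrib flip: abs_divide)
      also have "\<dots> \<le> \<phi> (Suc (Suc n)) (s / 2) * (y - s)\<^sup>2 / \<bar>y - s\<bar>"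
        using bound elim by (intro divide_right_mono) auto
      also have "\<dots> = \<phi> (Suc (Suc n)) (s / 2) * \<bar>y - s\<bar>"
        using power2_abs[of "y - s"] elim by (metis (no_types) abs_0_eq eq_iff_diff_eq_0
          nonzero_mult_div_cancel_right power2_eq_square times_divide_eq_right)
      finally show ?case .
    qed
    show "((\<lambda>y. \<phi> (Suc (Suc n)) (s / 2) * \<bar>y - s\<bar>) \<longlongrightarrow> 0) (at s)"
      by (auto intro!: tendsto_eq_intros)
  qed
  then have "((\<lambda>y. (\<phi> n y - \<phi> n s) / (y - s)) \<longlongrightarrow> - \<phi> (Suc n) s) (at s)"
    using tendsto_diff[of _ 0 _ "\<lambda>_. \<phi> (Suc n) s"] tendsto_const by fastforce
  then show ?thesis
    unfolding has_field_derivative_iff \<phi>_def .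
qed

text \<open>On both sides minus the derivative in \<open>s\<close> raises \<open>n\<close> by one,
  so uniqueness of derivatives yields the formula for \<open>Suc n\<close> from that for
  \<open>n\<close>, starting at the Laplace transform. The induction keeps \<open>s\<close>
  arbitrary because differentiating needs the formula on a neighbourhood of
  \<open>s\<close>.\<close>

lemma (in finite_measure) inverse_gaussian_moment:
  fixes X :: "'a \<Rightarrow> real"
  assumes X[measurable]: "X \<in> borel_measurable M" and nn: "\<And>\<omega>. \<omega> \<in> space M \<Longrightarrow> X \<omega> \<ge> 0"
    and laplace: "\<And>s. s > 0 \<Longrightarrow>
      (\<integral>\<omega>. exp (- (s * X \<omega>)) \<partial>M) = exp (- (g * (sqrt (2 * s + \<gamma>\<^sup>2) - \<gamma>)))"
    and "s > 0"
  shows "(\<integral>\<omega>. X \<omega> ^ n * exp (- (s * X \<omega>)) \<partial>M) = exp (\<gamma> * g) * ig_moment (sqrt (2 * s + \<gamma>\<^sup>2)) n g"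
  using \<open>s > 0\<close>
proof (induction n arbitrary: s)
  case 0
  then show ?case
    by (simp add: laplace algebra_simps flip: exp_add)
next
  case (Suc n)
  let ?r = "\<lambda>s. sqrt (2 * s + \<gamma>\<^sup>2)"
  have pos: "2 * s + \<gamma>\<^sup>2 > 0"
    using Suc.prems by (simp add: add_pos_nonneg)
  have "(?r has_real_derivative 1 / ?r s) (at s)"
    using pos by (auto intro!: derivative_eq_intros simp: field_simps)
  from DERIV_chain2[OF ig_moment_deriv_r this, of n g]
  have "((\<lambda>s. exp (\<gamma> * g) * ig_moment (?r s) n g) has_real_derivative
      exp (\<gamma> * g) * (- ?r s * ig_moment (?r s) (Suc n) g * (1 / ?r s))) (at s)"
    using pos by (intro DERIV_cmult) auto
  then have "((\<lambda>s. exp (\<gamma> * g) * ig_moment (?r s) n g) has_real_derivative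
      - (exp (\<gamma> * g) * ig_moment (?r s) (Suc n) g)) (at s)"
    using pos by (simp del: ig_moment.simps)
  then have "((\<lambda>s. \<integral>\<omega>. X \<omega> ^ n * exp (- (s * X \<omega>)) \<partial>M) has_real_derivative
      - (exp (\<gamma> * g) * ig_moment (?r s) (Suc n) g)) (at s)"
    by (rule has_field_derivative_transform_within_open[where S = "{0<..}"])
      (use Suc in auto)
  from DERIV_unique[OF laplace_moment_deriv[OF X nn Suc.prems] this]
  show ?case
    by linarith
qed

section \<open>Evaluating a process at an independent random time\<close>

lemma process_sigma_vimageI:
  "i \<in> I \<Longrightarrow> A \<in> sets S \<Longrightarrow> Y i -` A \<inter> space M \<in> process_sigma M I S Y"
  unfolding process_sigma_def by (rule sigma_sets.Basic) auto

lemma (in prob_space) prob_time_change: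
  fixes Y :: "real \<Rightarrow> 'a \<Rightarrow> nat" and T :: "'a \<Rightarrow> real"
  assumes T[measurable]: "T \<in> borel_measurable M" and T_nonneg: "\<And>\<omega>. \<omega> \<in> space M \<Longrightarrow> T \<omega> \<ge> 0"
    and indep: "indep_set (process_sigma M {0..} (count_space UNIV) Y) {T -` A \<inter> space M | A. A \<in> sets borel}"
    and right_cont: "\<And>\<omega> t. \<omega> \<in> space M \<Longrightarrow> t \<ge> 0 \<Longrightarrow> \<forall>\<^sub>F s in at_right t. Y s \<omega> = Y t \<omega>"
    and q: "\<And>s. s \<ge> 0 \<Longrightarrow> q s = prob {\<omega> \<in> space M. Y s \<omega> = m}"
    and q_cont: "continuous_on {0..} q"
  shows "prob {\<omega> \<in> space M. Y (T \<omega>) \<omega> = m} = expectation (\<lambda>\<omega>. q (T \<omega>))"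
  \<comment> \<open>\<open>T\<close> is approximated strictly from above by \<open>\<tau> n (J n \<omega>)\<close>, which has countable range.\<close>
proof -
  \<comment> \<open>The \<open>+ 1\<close> puts the grid point strictly above
    \<open>T \<omega>\<close> even when \<open>T \<omega>\<close> lies on the grid, as a limit along
    \<open>at_right\<close> requires.\<close>
  define \<tau> where "\<tau> = (\<lambda>n j. (real j + 1) / real (Suc n))"
  define J where "J = (\<lambda>n \<omega>. nat \<lfloor>real (Suc n) * T \<omega>\<rfloor>)"
  have J_meas[measurable]: "J n \<in> measurable M (count_space UNIV)" for n
    unfolding J_def by measurable
  have \<tau>_nonneg: "\<tau> n j \<ge> 0" for n j
    by (simp add: \<tau>_def)
  have Y_meas[measurable]: "Y (\<tau> n j) \<in> measurable M (count_space UNIV)" for n j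
  proof (rule measurableI)
    fix A assume "A \<in> sets (count_space (UNIV :: nat set))"
    then show "Y (\<tau> n j) -` A \<inter> space M \<in> events"
      using process_sigma_vimageI[of "\<tau> n j" "{0..}" A "count_space UNIV" Y M]
        indep_setD_ev1[OF indep] \<tau>_nonneg by auto
  qed simp
  have YJ_meas[measurable]: "(\<lambda>\<omega>. Y (\<tau> n (J n \<omega>)) \<omega>) \<in> measurable M (count_space UNIV)" for n
    by (rule measurable_compose_countable[where f = "\<lambda>j. Y (\<tau> n j)"]) measurable
  have gt: "\<tau> n (J n \<omega>) > T \<omega>" and le: "\<tau> n (J n \<omega>) \<le> T \<omega> + 1 / real (Suc n)" if "\<omega> \<in> space M" for n \<omega>
  proof -
    have "real (J n \<omega>) = of_int \<lfloor>real (Suc n) * T \<omega>\<rfloor>"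
      using T_nonneg[OF that] by (simp add: J_def)
    then have "real (J n \<omega>) + 1 > real (Suc n) * T \<omega>" "real (J n \<omega>) \<le> real (Suc n) * T \<omega>"
      by linarith+
    then show "\<tau> n (J n \<omega>) > T \<omega>" "\<tau> n (J n \<omega>) \<le> T \<omega> + 1 / real (Suc n)"
      by (simp_all add: \<tau>_def field_simps del: of_nat_Suc)
  qed
  have lim: "(\<lambda>n. \<tau> n (J n \<omega>)) \<longlonglongrightarrow> T \<omega>" if "\<omega> \<in> space M" for \<omega>
  proof (rule tendsto_sandwich[where f = "\<lambda>_. T \<omega>"])
    show "(\<lambda>n. T \<omega> + 1 / real (Suc n)) \<longlonglongrightarrow> T \<omega>"
      using tendsto_add[OF tendsto_const LIMSEQ_inverse_real_of_nat, of "T \<omega>"] by (simp add: inverse_eq_divide)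
  qed (use gt le that in \<open>auto intro!: always_eventually less_imp_le simp del: of_nat_Suc\<close>)
  have Y_lim: "\<forall>\<^sub>F n in sequentially. Y (\<tau> n (J n \<omega>)) \<omega> = Y (T \<omega>) \<omega>" if "\<omega> \<in> space M" for \<omega>
  proof -
    have "\<forall>\<^sub>F n in sequentially. \<tau> n (J n \<omega>) \<in> {T \<omega><..} \<and> \<tau> n (J n \<omega>) \<noteq> T \<omega>"
      using gt[OF that] by (intro always_eventually) (auto simp: less_imp_neq[symmetric])
    with lim[OF that] have "filterlim (\<lambda>n. \<tau> n (J n \<omega>)) (at_right (T \<omega>)) sequentially"
      by (simp add: filterlim_at)
    then show ?thesis
      using right_cont[OF that T_nonneg[OF that]] by (rule eventually_compose_filterlim[rotated])
  qed
  have q_lim: "(\<lambda>n. q (\<tau> n (J n \<omega>))) \<longlonglongrightarrow> q (T \<omega>)" if "\<omega> \<in> space M" for \<omega>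
    using q_cont lim[OF that] by (rule continuous_on_tendsto_compose) (auto simp: T_nonneg that \<tau>_nonneg)
  have q_bound: "norm (q s) \<le> 1" if "s \<ge> 0" for s
    by (simp add: q that)
  have partition: "expectation f = (\<Sum>j. LINT \<omega>:{\<omega> \<in> space M. J n \<omega> = j}|M. f \<omega>)"
    if "integrable M f" for f :: "'a \<Rightarrow> real" and n
  proof -
    have "(\<Union>j. {\<omega> \<in> space M. J n \<omega> = j}) = space M"
      by auto
    moreover have "integrable M (\<lambda>\<omega>. indicator (space M) \<omega> *\<^sub>R f \<omega>)"
      by (rule integrable_mult_indicator[OF sets.top that])
    moreover have "expectation f = (LINT \<omega>:space M|M. f \<omega>)"
      unfolding set_lebesgue_integral_def by (rule Bochner_Integration.integral_cong) auto
    ultimately show ?thesis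
      using lebesgue_integral_countable_add[of "\<lambda>j. {\<omega> \<in> space M. J n \<omega> = j}" M f]
      by (auto simp: set_integrable_def)
  qed
  have qJ_meas[measurable]: "(\<lambda>\<omega>. q (\<tau> n (J n \<omega>))) \<in> borel_measurable M" for n
    by measurable
  have indJ_meas[measurable]: "(\<lambda>\<omega>. indicator {m} (Y (\<tau> n (J n \<omega>)) \<omega>) :: real) \<in> borel_measurable M" for n
    using YJ_meas by (rule measurable_compose) simp
  \<comment> \<open>On the event \<open>J n \<omega> = j\<close> the time is the constant
    \<open>\<tau> n j\<close>, so independence factors the probability; the pieces are then summed
    over \<open>j\<close>.\<close>
  have discrete: "expectation (\<lambda>\<omega>. indicator {m} (Y (\<tau> n (J n \<omega>)) \<omega>)) = expectation (\<lambda>\<omega>. q (\<tau> n (J n \<omega>)))"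
    for n
  proof -
    have "(LINT \<omega>:{\<omega> \<in> space M. J n \<omega> = j}|M. indicator {m} (Y (\<tau> n (J n \<omega>)) \<omega>))
        = (LINT \<omega>:{\<omega> \<in> space M. J n \<omega> = j}|M. q (\<tau> n (J n \<omega>)))" for j
    proof -
      have "(LINT \<omega>:{\<omega> \<in> space M. J n \<omega> = j}|M. indicator {m} (Y (\<tau> n (J n \<omega>)) \<omega>))
          = (LINT \<omega>|M. indicator ({\<omega> \<in> space M. Y (\<tau> n j) \<omega> = m} \<inter> {\<omega> \<in> space M. J n \<omega> = j}) \<omega>)"
        unfolding set_lebesgue_integral_def
        by (intro Bochner_Integration.integral_cong) (auto simp: indicator_def)
      also have "\<dots> = prob ({\<omega> \<in> space M. Y (\<tau> n j) \<omega> = m} \<inter> {\<omega> \<in> space M. J n \<omega> = j})"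
        by simp
      also have "\<dots> = prob {\<omega> \<in> space M. Y (\<tau> n j) \<omega> = m} * prob {\<omega> \<in> space M. J n \<omega> = j}"
      proof (rule indep_setD[OF indep])
        show "{\<omega> \<in> space M. Y (\<tau> n j) \<omega> = m} \<in> process_sigma M {0..} (count_space UNIV) Y"
          using process_sigma_vimageI[of "\<tau> n j" "{0..}" "{m}" "count_space UNIV" Y M] \<tau>_nonneg
          by (simp add: vimage_def Int_def conj_commute)
        have "{x. nat \<lfloor>real (Suc n) * x\<rfloor> = j} \<in> sets borel"
          by measurable
        then show "{\<omega> \<in> space M. J n \<omega> = j} \<in> {T -` A \<inter> space M | A. A \<in> sets borel}"
          by (intro CollectI exI[of _ "{x. nat \<lfloor>real (Suc n) * x\<rfloor> = j}"]) (auto simp: J_def)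
      qed
      also have "\<dots> = (LINT \<omega>|M. q (\<tau> n j) * indicator {\<omega> \<in> space M. J n \<omega> = j} \<omega>)"
        by (simp add: q \<tau>_nonneg)
      also have "\<dots> = (LINT \<omega>:{\<omega> \<in> space M. J n \<omega> = j}|M. q (\<tau> n (J n \<omega>)))"
        unfolding set_lebesgue_integral_def
        by (intro Bochner_Integration.integral_cong) (auto simp: indicator_def)
      finally show ?thesis .
    qed
    moreover have "integrable M (\<lambda>\<omega>. indicator {m} (Y (\<tau> n (J n \<omega>)) \<omega>) :: real)"
      by (rule integrable_const_bound[where B = 1]) (auto simp: indicator_def)
    moreover have "integrable M (\<lambda>\<omega>. q (\<tau> n (J n \<omega>)))"
      by (rule integrable_const_bound[where B = 1]) (use q_bound \<tau>_nonneg in auto)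
    ultimately show ?thesis
      by (simp only: partition[of _ n])
  qed
  have ind_lim: "(\<lambda>n. indicator {m} (Y (\<tau> n (J n \<omega>)) \<omega>)) \<longlonglongrightarrow> (indicator {m} (Y (T \<omega>) \<omega>) :: real)"
    if "\<omega> \<in> space M" for \<omega>
    using Y_lim[OF that] by (intro tendsto_eventually) (auto elim: eventually_mono)
  \<comment> \<open>Measurability at the random time itself comes from the pointwise limit of the
    grid approximations.\<close>
  have ind_meas[measurable]: "(\<lambda>\<omega>. indicator {m} (Y (T \<omega>) \<omega>) :: real) \<in> borel_measurable M"
    by (rule borel_measurable_LIMSEQ_real[OF ind_lim indJ_meas])
  have q_meas[measurable]: "(\<lambda>\<omega>. q (T \<omega>)) \<in> borel_measurable M"
    by (rule borel_measurable_LIMSEQ_real[OF q_lim qJ_meas])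
  have "(\<lambda>n. expectation (\<lambda>\<omega>. indicator {m} (Y (\<tau> n (J n \<omega>)) \<omega>))) \<longlonglongrightarrow>
      expectation (\<lambda>\<omega>. indicator {m} (Y (T \<omega>) \<omega>) :: real)"
    by (rule integral_dominated_convergence[where w = "\<lambda>_. 1"])
      (use ind_meas indJ_meas ind_lim in \<open>simp_all add: indicator_le_1\<close>)
  moreover have "(\<lambda>n. expectation (\<lambda>\<omega>. q (\<tau> n (J n \<omega>)))) \<longlonglongrightarrow> expectation (\<lambda>\<omega>. q (T \<omega>))"
    by (rule integral_dominated_convergence[where w = "\<lambda>_. 1"])
      (use q_meas qJ_meas q_lim q_bound \<tau>_nonneg in simp_all)
  ultimately have "expectation (\<lambda>\<omega>. indicator {m} (Y (T \<omega>) \<omega>)) = expectation (\<lambda>\<omega>. q (T \<omega>))"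
    unfolding discrete by (rule LIMSEQ_unique)
  moreover have "{\<omega> \<in> space M. Y (T \<omega>) \<omega> = m} \<in> events"
  proof -
    have "{\<omega> \<in> space M. indicator {m} (Y (T \<omega>) \<omega>) = (1 :: real)} \<in> events"
      by measurable
    then show ?thesis
      by (simp add: indicator_eq_1_iff)
  qed
  then have "prob {\<omega> \<in> space M. Y (T \<omega>) \<omega> = m}
      = expectation (indicator {\<omega> \<in> space M. Y (T \<omega>) \<omega> = m})"
    by simp
  moreover have "\<dots> = expectation (\<lambda>\<omega>. indicator {m} (Y (T \<omega>) \<omega>))"
    by (intro Bochner_Integration.integral_cong) (auto simp: indicator_def)
  ultimately show ?thesis
    by simp
qed

section \<open>Distribution of the Poisson process of order k\<close>

text \<open>The recursion conditions on the last jump \<open>j\<close>. The bound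
  \<open>min m k\<close> keeps \<open>m - j\<close> free of truncation and is the range of the sum
  in the final equation.\<close>

fun uniform_sum_prob :: "nat \<Rightarrow> nat \<Rightarrow> nat \<Rightarrow> real" where
  "uniform_sum_prob k 0 m = of_bool (m = 0)"
| "uniform_sum_prob k (Suc n) m = (\<Sum>j=1..min m k. uniform_sum_prob k n (m - j)) / real k"

text \<open>Every jump is at least 1; this makes the sums over the number of jumps finite.\<close>

lemma uniform_sum_prob_eq_0: "m < n \<Longrightarrow> uniform_sum_prob k n m = 0"
  by (induction n arbitrary: m) (auto intro!: sum.neutral)

text \<open>The last jump is independent of the sum of the earlier ones, so the law of the sum is a
  convolution, which is the recursion of \<open>uniform_sum_prob\<close>.\<close>

lemma (in prob_space) prob_sum_uniform:
  fixes X :: "nat \<Rightarrow> 'a \<Rightarrow> nat"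
  assumes indep: "indep_vars (\<lambda>_. count_space UNIV) X {1..}"
    and unif: "\<And>i. i \<ge> 1 \<Longrightarrow> distr M (count_space UNIV) (X i) = measure_pmf (pmf_of_set {1..k})"
    and k: "k \<ge> 1"
  shows "prob {\<omega> \<in> space M. (\<Sum>i=1..n. X i \<omega>) = m} = uniform_sum_prob k n m"
proof (induction n arbitrary: m)
  case 0
  then show ?case
    by (cases "m = 0") (simp_all add: prob_space)
next
  case (Suc n)
  have X[measurable]: "X i \<in> measurable M (count_space UNIV)" if "i \<ge> 1" for i
    using indep that by (auto simp: indep_vars_def)
  define S where "S = (\<lambda>\<omega>. \<Sum>i=1..n. X i \<omega>)"
  have S[measurable]: "S \<in> measurable M (count_space UNIV)"
    unfolding S_def by (rule measurable_sum_nat) (auto intro: X)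
  have X': "X (Suc n) \<in> measurable M (count_space UNIV)"
    by (rule X) simp
  note X'[measurable]
  have IH: "prob {\<omega> \<in> space M. S \<omega> = l} = uniform_sum_prob k n l" for l
    unfolding S_def by (rule Suc)
  have "indep_vars (\<lambda>_. borel) (\<lambda>i \<omega>. real (X i \<omega>)) (insert (Suc n) {1..n})"
    by (rule indep_vars_compose2[OF indep_vars_subset[OF indep]]) auto
  then have ind: "indep_var borel (\<lambda>\<omega>. real (X (Suc n) \<omega>)) borel (\<lambda>\<omega>. \<Sum>i=1..n. real (X i \<omega>))"
    by (intro indep_vars_sum) auto
  have joint: "prob {\<omega> \<in> space M. X (Suc n) \<omega> = j \<and> S \<omega> = l}
      = prob {\<omega> \<in> space M. X (Suc n) \<omega> = j} * prob {\<omega> \<in> space M. S \<omega> = l}" for j l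
  proof -
    have "(\<Sum>i=1..n. real (X i \<omega>)) = real l \<longleftrightarrow> S \<omega> = l" for \<omega>
      unfolding S_def by (simp flip: of_nat_sum)
    then show ?thesis
      using indep_varD[OF ind, of "{real j}" "{real l}"]
      by (simp add: vimage_def Int_def conj_commute)
  qed
  have one: "prob {\<omega> \<in> space M. X (Suc n) \<omega> = j} = indicator {1..k} j / real k" for j
  proof -
    have "prob {\<omega> \<in> space M. X (Suc n) \<omega> = j} = measure (distr M (count_space UNIV) (X (Suc n))) {j}"
      by (subst measure_distr) (auto simp: vimage_def Int_def conj_commute)
    also have "\<dots> = pmf (pmf_of_set {1..k}) j"
      by (simp add: unif pmf.rep_eq)
    finally show ?thesis
      using k by simp
  qed
  have "{\<omega> \<in> space M. (\<Sum>i=1..Suc n. X i \<omega>) = m}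
      = (\<Union>j\<in>{..m}. {\<omega> \<in> space M. X (Suc n) \<omega> = j \<and> S \<omega> = m - j})"
    by (auto simp: S_def)
  then have "prob {\<omega> \<in> space M. (\<Sum>i=1..Suc n. X i \<omega>) = m}
      = (\<Sum>j\<le>m. prob {\<omega> \<in> space M. X (Suc n) \<omega> = j \<and> S \<omega> = m - j})"
    by (simp only:) (rule finite_measure_finite_Union, auto simp: disjoint_family_on_def)
  also have "\<dots> = (\<Sum>j\<le>m. indicator {1..k} j / real k * uniform_sum_prob k n (m - j))"
    by (simp only: joint one IH)
  also have "\<dots> = (\<Sum>j=1..min m k. uniform_sum_prob k n (m - j) / real k)"
    by (rule sum.mono_neutral_cong_right) (auto simp: indicator_def)
  finally show ?case
    by (simp add: sum_divide_distrib)
qed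

lemma (in poisson_process) prob_poisson:
  assumes "r > 0" "t \<ge> 0"
  shows "prob {\<omega> \<in> space M. N t \<omega> = n} = (r * t) ^ n / fact n * exp (- (r * t))"
proof (cases "t = 0")
  \<comment> \<open>Time zero is separate because \<open>poisson_incs\<close> requires
    \<open>s < t\<close>; the formula then relies on \<open>0 ^ 0 = 1\<close>.\<close>
  case True
  then have "{\<omega> \<in> space M. N t \<omega> = n} = (if n = 0 then space M else {})"
    using zero by auto
  then show ?thesis
    using True by (simp add: prob_space)
next
  case False
  then have pos: "r * t > 0"
    using assms by simp
  have [measurable]: "N t \<in> measurable M (count_space UNIV)"
    by (rule rv) (use assms in auto)
  have "prob {\<omega> \<in> space M. N t \<omega> = n} = measure (distr M (count_space UNIV) (N t)) {n}"
    by (subst measure_distr) (auto simp: vimage_def Int_def conj_commute)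
  also have "distr M (count_space UNIV) (N t) = distr M (count_space UNIV) (\<lambda>\<omega>. N t \<omega> - N 0 \<omega>)"
    by (rule distr_cong) (auto simp: zero)
  also have "\<dots> = measure_pmf (poisson_pmf (r * t))"
    using poisson_incs[of 0 t] False assms by simp
  also have "measure \<dots> {n} = pmf (poisson_pmf (r * t)) n"
    by (simp add: pmf.rep_eq)
  finally show ?thesis
    using pos by simp
qed

text \<open>The law at time \<open>s\<close>, split by the number \<open>n\<close> of Poisson
  events. The factors containing \<open>s\<close> are grouped so that putting \<open>G t\<close> for
  \<open>s\<close> and taking expectations produces tempered moments.\<close>

definition ppok_prob :: "nat \<Rightarrow> real \<Rightarrow> nat \<Rightarrow> real \<Rightarrow> real" where
  "ppok_prob k lam m s =
     (\<Sum>n\<le>m. uniform_sum_prob k n m * (real k * lam) ^ n / fact n * (s ^ n * exp (- (real k * lam * s))))"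

lemma (in prob_space) prob_poisson_process_of_order:
  assumes "poisson_process_of_order M k lam Nk" and k: "k \<ge> 1" and "lam > 0" and "s \<ge> 0"
  shows "prob {\<omega> \<in> space M. Nk s \<omega> = m} = ppok_prob k lam m s"
proof -
  obtain N X where N: "poisson_process M N (real k * lam)"
    and X0: "\<And>\<omega>. \<omega> \<in> space M \<Longrightarrow> X 0 \<omega> = (0 :: nat)"
    and indep: "indep_vars (\<lambda>_. count_space UNIV) X {1..}"
    and unif: "\<And>i. i \<ge> 1 \<Longrightarrow> distr M (count_space UNIV) (X i) = measure_pmf (pmf_of_set {1..k})"
    and NX: "indep_set (process_sigma M {0..} (count_space UNIV) N) (process_sigma M {1..} (count_space UNIV) X)"
    and Nk: "\<And>t \<omega>. t \<ge> 0 \<Longrightarrow> \<omega> \<in> space M \<Longrightarrow> Nk t \<omega> = (\<Sum>i=0..N t \<omega>. X i \<omega>)"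
    using assms(1) unfolding poisson_process_of_order_def by blast
  interpret N: poisson_process M N "real k * lam" by (rule N)
  let ?A = "\<lambda>n. {\<omega> \<in> space M. N s \<omega> = n}" and ?B = "\<lambda>n. {\<omega> \<in> space M. (\<Sum>i=1..n. X i \<omega>) = m}"
  have A: "?A n \<in> process_sigma M {0..} (count_space UNIV) N" for n
    using process_sigma_vimageI[of s "{0..}" "{n}" "count_space UNIV" N M] \<open>s \<ge> 0\<close>
    by (simp add: vimage_def Int_def conj_commute)
  \<comment> \<open>Independence concerns the generated sigma-algebras, so the event about the sum
    must lie in the one generated by \<open>X\<close>, not merely in \<open>M\<close>.\<close>
  have B: "?B n \<in> process_sigma M {1..} (count_space UNIV) X" for n
  proof -
    let ?G = "{X i -` A \<inter> space M |i A. i \<in> {1..} \<and> A \<in> sets (count_space (UNIV :: nat set))}"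
    have G: "?G \<subseteq> Pow (space M)"
      by auto
    have "X i \<in> measurable (sigma (space M) ?G) (count_space UNIV)" if "i \<in> {1..n}" for i
    proof (rule measurableI)
      fix A :: "nat set" assume "A \<in> sets (count_space UNIV)"
      then show "X i -` A \<inter> space (sigma (space M) ?G) \<in> sets (sigma (space M) ?G)"
        using that G by (auto intro!: sigma_sets.Basic)
    qed simp
    then have "(\<lambda>\<omega>. \<Sum>i=1..n. X i \<omega>) \<in> measurable (sigma (space M) ?G) (count_space UNIV)"
      by (rule measurable_sum_nat)
    from measurable_sets[OF this, of "{m}"] show ?thesis
      using G by (simp add: process_sigma_def vimage_def Int_def conj_commute)
  qed
  have AB: "prob (?A n \<inter> ?B n)
      = uniform_sum_prob k n m * (real k * lam) ^ n / fact n * (s ^ n * exp (- (real k * lam * s)))" for n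
  proof -
    have "prob (?A n \<inter> ?B n) = (real k * lam * s) ^ n / fact n * exp (- (real k * lam * s)) * uniform_sum_prob k n m"
      using N.prob_poisson[of s n] assms prob_sum_uniform[OF indep unif k, of n m]
      by (subst indep_setD[OF NX A B]) simp_all
    then show ?thesis
      by (simp add: power_mult_distrib)
  qed
  \<comment> \<open>The pieces are indexed by the value of \<open>N s\<close>; the summand with
    index 0 vanishes by \<open>X0\<close>.\<close>
  have union: "{\<omega> \<in> space M. Nk s \<omega> = m} = (\<Union>n. ?A n \<inter> ?B n)"
    using \<open>s \<ge> 0\<close> by (auto simp: Nk X0 sum.atLeast_Suc_atMost)
  have "(\<lambda>n. prob (?A n \<inter> ?B n)) sums prob (\<Union>n. ?A n \<inter> ?B n)"
  proof (rule finite_measure_UNION)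
    show "range (\<lambda>n. ?A n \<inter> ?B n) \<subseteq> events"
      using A B indep_setD_ev1[OF NX] indep_setD_ev2[OF NX] by blast
  qed (auto simp: disjoint_family_on_def)
  moreover have "(\<lambda>n. prob (?A n \<inter> ?B n)) sums (\<Sum>n\<le>m. prob (?A n \<inter> ?B n))"
    by (rule sums_finite) (simp_all only: AB, simp_all add: uniform_sum_prob_eq_0)
  ultimately have "prob {\<omega> \<in> space M. Nk s \<omega> = m} = (\<Sum>n\<le>m. prob (?A n \<inter> ?B n))"
    unfolding union by (rule sums_unique2)
  then show ?thesis
    by (simp only: ppok_prob_def AB)
qed

text \<open>A right-continuous path with values in the naturals is constant just to the right of
  \<open>t\<close>, and \<open>Nk\<close> changes only when \<open>N\<close> does.\<close>

lemma poisson_process_of_order_right_continuous: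
  assumes "poisson_process_of_order M k lam Nk" "\<omega> \<in> space M" "t \<ge> 0"
  shows "\<forall>\<^sub>F s in at_right t. Nk s \<omega> = Nk t \<omega>"
proof -
  obtain N X where N: "poisson_process M N (real k * lam)"
    and Nk: "\<And>t \<omega>. t \<ge> 0 \<Longrightarrow> \<omega> \<in> space M \<Longrightarrow> Nk t \<omega> = (\<Sum>i=0..N t \<omega>. X i \<omega> :: nat)"
    using assms(1) unfolding poisson_process_of_order_def by blast
  interpret N: poisson_process M N "real k * lam" by (rule N)
  have "\<forall>\<^sub>F s in at_right t. N s \<omega> = N t \<omega>"
    using N.right_continuous[OF assms(2,3)] by (simp add: continuous_within tendsto_discrete)
  moreover have "\<forall>\<^sub>F s in at_right t. s > t"
    by (rule eventually_at_right_less)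
  ultimately show ?thesis
    by eventually_elim (use assms Nk in auto)
qed

section \<open>The differential equation for the coefficients and for the moments\<close>

text \<open>In the sum of \<open>real n * \<mu> (n - 1)\<close> the index is shifted: the factor
  \<open>n\<close> cancels against the factorial and sets free one \<open>real k * lam\<close>. Its
  \<open>k\<close> cancels the division by \<open>k\<close> in \<open>uniform_sum_prob\<close>,
  leaving \<open>lam\<close> times a sum over the last jump \<open>j\<close>. The sequence
  \<open>\<mu>\<close> is arbitrary, so the identity can be applied at each fixed time.\<close>

lemma ppok_prob_generator:
  fixes \<mu> :: "nat \<Rightarrow> real" and lam :: real
  assumes "k \<ge> 1"
  defines "P \<equiv> \<lambda>m. \<Sum>n\<le>m. uniform_sum_prob k n m * (real k * lam) ^ n / fact n * \<mu> n"
  shows "(\<Sum>n\<le>m. uniform_sum_prob k n m * (real k * lam) ^ n / fact n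
           * (real k * lam * \<mu> n - real n * \<mu> (n - 1)))
         = lam * (real k * P m - (\<Sum>j=1..min m k. P (m - j)))"
proof -
  define c where "c = (\<lambda>n m. uniform_sum_prob k n m * (real k * lam) ^ n / fact n)"
  \<comment> \<open>A summation range independent of \<open>j\<close> allows the two sums to be
    swapped; the added terms are zero because \<open>n\<close> jumps add up to at least
    \<open>n\<close>.\<close>
  have P_extend: "P (m - j) = (\<Sum>n<m. c n (m - j) * \<mu> n)" if "j \<in> {1..min m k}" for j
    unfolding P_def c_def
    by (rule sum.mono_neutral_left) (use that in \<open>auto simp: uniform_sum_prob_eq_0\<close>)
  have "(\<Sum>n\<le>m. c n m * (real n * \<mu> (n - 1))) = (\<Sum>n<m. c (Suc n) m * (real (Suc n) * \<mu> n))"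
    by (cases m) (simp_all add: sum.atMost_Suc_shift lessThan_Suc_atMost del: sum.atMost_Suc)
  also have "\<dots> = (\<Sum>n<m. lam * (\<Sum>j=1..min m k. c n (m - j) * \<mu> n))"
  proof (rule sum.cong)
    fix n
    have "c (Suc n) m * (real (Suc n) * \<mu> n)
        = real k * lam * (uniform_sum_prob k (Suc n) m * (real k * lam) ^ n / fact n) * \<mu> n"
      by (simp add: c_def field_simps del: of_nat_Suc uniform_sum_prob.simps)
    also have "\<dots> = lam * ((\<Sum>j=1..min m k. uniform_sum_prob k n (m - j)) * (real k * lam) ^ n / fact n * \<mu> n)"
      using assms by (simp add: field_simps)
    also have "\<dots> = lam * (\<Sum>j=1..min m k. c n (m - j) * \<mu> n)"
      by (simp add: c_def sum_distrib_right sum_divide_distrib)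
    finally show "c (Suc n) m * (real (Suc n) * \<mu> n) = lam * (\<Sum>j=1..min m k. c n (m - j) * \<mu> n)" .
  qed simp
  also have "\<dots> = lam * (\<Sum>j=1..min m k. \<Sum>n<m. c n (m - j) * \<mu> n)"
    by (subst sum.swap) (simp add: sum_distrib_left)
  also have "\<dots> = lam * (\<Sum>j=1..min m k. P (m - j))"
    by (simp add: P_extend)
  finally have "(\<Sum>n\<le>m. c n m * (real n * \<mu> (n - 1))) = lam * (\<Sum>j=1..min m k. P (m - j))" .
  moreover have "(\<Sum>n\<le>m. c n m * (real k * lam * \<mu> n)) = lam * (real k * P m)"
    by (simp add: P_def c_def sum_distrib_left ac_simps)
  ultimately show ?thesis
    unfolding c_def by (simp only: right_diff_distrib sum_subtractf)
qed

text \<open>For \<mu>(t) = exp(\<gamma> \<delta> t) B(\<delta> t), subtracting 2 \<delta> \<gamma>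
  \<mu>' removes B' and leaves \<delta>^2 exp(\<gamma> \<delta> t) (B'' - \<gamma>^2 B), evaluated
  at \<delta> t. The equation for B'' and r^2 - \<gamma>^2 = 2 a give the right-hand side.\<close>

lemma ig_moment_ode:
  assumes "a > 0"
  shows "\<exists>\<mu>' \<mu>''. \<forall>t.
    ((\<lambda>t. exp (\<gamma> * (\<delta> * t)) * ig_moment (sqrt (2 * a + \<gamma>\<^sup>2)) n (\<delta> * t)) has_real_derivative \<mu>' t) (at t) \<and>
    (\<mu>' has_real_derivative \<mu>'' t) (at t) \<and>
    \<mu>'' t - 2 * \<delta> * \<gamma> * \<mu>' t = 2 * \<delta>\<^sup>2 * (exp (\<gamma> * (\<delta> * t)) *
      (a * ig_moment (sqrt (2 * a + \<gamma>\<^sup>2)) n (\<delta> * t) - real n * ig_moment (sqrt (2 * a + \<gamma>\<^sup>2)) (n - 1) (\<delta> * t)))"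
proof -
  define r where "r = sqrt (2 * a + \<gamma>\<^sup>2)"
  have pos: "2 * a + \<gamma>\<^sup>2 > 0"
    using assms by (simp add: add_pos_nonneg)
  then have r: "r > 0" "r\<^sup>2 = 2 * a + \<gamma>\<^sup>2"
    by (simp_all add: r_def)
  define B where "B = ig_moment r n"
  define C where "C = ig_moment r (n - 1)"
  obtain D where D: "\<And>g. (B has_real_derivative D g) (at g)"
    "\<And>g. (D has_real_derivative r\<^sup>2 * B g - 2 * real n * C g) (at g)"
    using ig_moment_deriv_g[OF r(1), of n] unfolding B_def C_def by blast
  let ?e = "\<lambda>t. exp (\<gamma> * (\<delta> * t))"
  have e: "(?e has_real_derivative \<gamma> * \<delta> * ?e t) (at t)" for t
    by (auto intro!: derivative_eq_intros)
  have lin: "((\<lambda>t. \<delta> * t) has_real_derivative \<delta>) (at t)" for t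
    by (auto intro!: derivative_eq_intros)
  define \<mu>' where "\<mu>' = (\<lambda>t. \<delta> * (?e t * (\<gamma> * B (\<delta> * t) + D (\<delta> * t))))"
  define \<mu>'' where "\<mu>'' = (\<lambda>t. \<delta> * (\<gamma> * \<delta> * ?e t * (\<gamma> * B (\<delta> * t) + D (\<delta> * t))
    + (\<gamma> * (D (\<delta> * t) * \<delta>) + (r\<^sup>2 * B (\<delta> * t) - 2 * real n * C (\<delta> * t)) * \<delta>) * ?e t))"
  have 1: "((\<lambda>t. ?e t * B (\<delta> * t)) has_real_derivative \<mu>' t) (at t)" for t
    using DERIV_mult[OF e DERIV_chain2[OF D(1) lin], of t]
    by (simp add: \<mu>'_def algebra_simps)
  have 2: "(\<mu>' has_real_derivative \<mu>'' t) (at t)" for t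
    unfolding \<mu>'_def \<mu>''_def
    by (intro DERIV_cmult DERIV_mult DERIV_add e DERIV_chain2[OF D(1) lin] DERIV_chain2[OF D(2) lin])
  have 3: "\<mu>'' t - 2 * \<delta> * \<gamma> * \<mu>' t = 2 * \<delta>\<^sup>2 * (?e t * (a * B (\<delta> * t) - real n * C (\<delta> * t)))" for t
    by (simp add: \<mu>'_def \<mu>''_def r(2)[unfolded power2_eq_square] algebra_simps power2_eq_square)
  show ?thesis
    unfolding r_def[symmetric] B_def[symmetric] C_def[symmetric] using 1 2 3 by blast
qed

section \<open>The subordinated process\<close>

text \<open>The time change formula turns the probability into the expectation of
  \<open>ppok_prob\<close> at \<open>G t\<close>, a finite sum of tempered moments, whose closed
  form is known.\<close>

lemma p_hat_eq:
  assumes "k \<ge> 1" and "lam > 0"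
    and Nk: "poisson_process_of_order M k lam Nk"
    and G: "inverse_gaussian_subordinator M G \<delta> \<gamma>"
    and indep: "prob_space.indep_set M
           (process_sigma M {0..} (count_space UNIV) Nk) (process_sigma M {0..} borel G)"
    and t: "t \<ge> 0"
  shows "p_hat M Nk G m t = (\<Sum>n\<le>m. uniform_sum_prob k n m * (real k * lam) ^ n / fact n *
    (exp (\<gamma> * (\<delta> * t)) * ig_moment (sqrt (2 * (real k * lam) + \<gamma>\<^sup>2)) n (\<delta> * t)))"
proof -
  interpret inverse_gaussian_subordinator M G \<delta> \<gamma> by (rule G)
  have G_meas[measurable]: "G t \<in> borel_measurable M"
    by (rule rv) (rule t)
  have G_nonneg: "G t \<omega> \<ge> 0" if "\<omega> \<in> space M" for \<omega>
    using nondecreasing[OF that] t by (auto simp: zero[OF that] dest: monotone_onD[where x = 0 and y = t])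
  have a: "real k * lam > 0"
    using assms by simp
  \<comment> \<open>Independence of the whole subordinator is weakened to independence of its value
    at the single time \<open>t\<close>.\<close>
  have indep_Gt: "indep_set (process_sigma M {0..} (count_space UNIV) Nk) {G t -` A \<inter> space M |A. A \<in> sets borel}"
    using indep unfolding indep_set_def
    by (rule indep_sets_mono_sets) (auto split: bool.split intro!: process_sigma_vimageI t)
  have "p_hat M Nk G m t = expectation (\<lambda>\<omega>. ppok_prob k lam m (G t \<omega>))"
    unfolding p_hat_def
  proof (rule prob_time_change[OF G_meas G_nonneg indep_Gt])
    show "\<forall>\<^sub>F s in at_right t. Nk s \<omega> = Nk t \<omega>" if "\<omega> \<in> space M" "t \<ge> 0" for \<omega> t
      using Nk that by (rule poisson_process_of_order_right_continuous)
    show "ppok_prob k lam m s = prob {\<omega> \<in> space M. Nk s \<omega> = m}" if "s \<ge> 0" for s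
      using prob_poisson_process_of_order[OF Nk] assms that by simp
    show "continuous_on {0..} (ppok_prob k lam m)"
      unfolding ppok_prob_def by (intro continuous_intros) auto
  qed auto
  also have "\<dots> = (\<Sum>n\<le>m. uniform_sum_prob k n m * (real k * lam) ^ n / fact n *
      expectation (\<lambda>\<omega>. G t \<omega> ^ n * exp (- (real k * lam * G t \<omega>))))"
    unfolding ppok_prob_def using integrable_power_mult_exp[OF G_meas G_nonneg a]
    by (subst Bochner_Integration.integral_sum) auto
  moreover have "expectation (\<lambda>\<omega>. G t \<omega> ^ n * exp (- (real k * lam * G t \<omega>)))
      = exp (\<gamma> * (\<delta> * t)) * ig_moment (sqrt (2 * (real k * lam) + \<gamma>\<^sup>2)) n (\<delta> * t)" for n
  proof (rule inverse_gaussian_moment[OF G_meas G_nonneg _ a])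
    show "expectation (\<lambda>\<omega>. exp (- (s * G t \<omega>))) = exp (- (\<delta> * t * (sqrt (2 * s + \<gamma>\<^sup>2) - \<gamma>)))"
      if "s > 0" for s
      using laplace_transform[OF t, of s] that by (simp add: ac_simps)
  qed
  ultimately show ?thesis
    by simp
qed

theorem theorem5p1:
  fixes M :: "'a measure" and k m :: nat and lam \<delta> \<gamma> :: real
    and Nk :: "real \<Rightarrow> 'a \<Rightarrow> nat" and G :: "real \<Rightarrow> 'a \<Rightarrow> real"
  assumes "prob_space M"
    and "k \<ge> 1" and "lam > 0" and "\<delta> > 0" and "\<gamma> > 0"
    and "poisson_process_of_order M k lam Nk"
    and "inverse_gaussian_subordinator M G \<delta> \<gamma>"
    and "prob_space.indep_set M
           (process_sigma M {0..} (count_space UNIV) Nk) (process_sigma M {0..} borel G)"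
  shows "\<exists>p' p'' :: real \<Rightarrow> real. \<forall>t\<ge>0.
           (p_hat M Nk G m has_real_derivative p' t) (at t within {0..}) \<and>
           (p' has_real_derivative p'' t) (at t within {0..}) \<and>
           p'' t - 2 * \<delta> * \<gamma> * p' t =
             2 * \<delta>\<^sup>2 * lam *
               (real k * p_hat M Nk G m t - (\<Sum>j=1..min m k. p_hat M Nk G (m - j) t))"
proof -
  define c where "c = (\<lambda>n m. uniform_sum_prob k n m * (real k * lam) ^ n / fact n)"
  define \<mu> where "\<mu> = (\<lambda>n t. exp (\<gamma> * (\<delta> * t)) * ig_moment (sqrt (2 * (real k * lam) + \<gamma>\<^sup>2)) n (\<delta> * t))"
  have p_hat: "p_hat M Nk G m t = (\<Sum>n\<le>m. c n m * \<mu> n t)" if "t \<ge> 0" for m t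
    unfolding c_def \<mu>_def using that by (intro p_hat_eq assms)
  have "real k * lam > 0"
    using assms by simp
  then have "\<forall>n. \<exists>\<mu>' \<mu>''. \<forall>t. (\<mu> n has_real_derivative \<mu>' t) (at t) \<and> (\<mu>' has_real_derivative \<mu>'' t) (at t) \<and>
      \<mu>'' t - 2 * \<delta> * \<gamma> * \<mu>' t = 2 * \<delta>\<^sup>2 * (real k * lam * \<mu> n t - real n * \<mu> (n - 1) t)"
    using ig_moment_ode[of "real k * lam" \<gamma> \<delta>] unfolding \<mu>_def
    by (simp only: right_diff_distrib mult.left_commute[of "exp _"]) blast
  then obtain \<mu>' \<mu>'' where
      1: "\<And>n t. (\<mu> n has_real_derivative \<mu>' n t) (at t)"
    and 2: "\<And>n t. (\<mu>' n has_real_derivative \<mu>'' n t) (at t)"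
    and 3: "\<And>n t. \<mu>'' n t - 2 * \<delta> * \<gamma> * \<mu>' n t = 2 * \<delta>\<^sup>2 * (real k * lam * \<mu> n t - real n * \<mu> (n - 1) t)"
    by metis
  show ?thesis
  proof (intro exI allI impI conjI)
    fix t :: real assume t: "t \<ge> 0"
    have "((\<lambda>t. \<Sum>n\<le>m. c n m * \<mu> n t) has_real_derivative (\<Sum>n\<le>m. c n m * \<mu>' n t)) (at t within {0..})"
      by (intro DERIV_sum DERIV_cmult has_field_derivative_at_within[OF 1])
    \<comment> \<open>The sum is differentiable on the whole line but is known to agree with
      \<open>p_hat\<close> only on \<open>{0..}\<close>, so the derivative is taken within that set
      and is one-sided at 0.\<close>
    then show "(p_hat M Nk G m has_real_derivative (\<Sum>n\<le>m. c n m * \<mu>' n t)) (at t within {0..})"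
      by (rule has_field_derivative_transform_within[where d = 1]) (use t p_hat in auto)
    show "((\<lambda>t. \<Sum>n\<le>m. c n m * \<mu>' n t) has_real_derivative (\<Sum>n\<le>m. c n m * \<mu>'' n t)) (at t within {0..})"
      by (intro DERIV_sum DERIV_cmult has_field_derivative_at_within[OF 2])
    have "(\<Sum>n\<le>m. c n m * \<mu>'' n t) - 2 * \<delta> * \<gamma> * (\<Sum>n\<le>m. c n m * \<mu>' n t)
        = (\<Sum>n\<le>m. c n m * (\<mu>'' n t - 2 * \<delta> * \<gamma> * \<mu>' n t))"
      by (simp add: sum_distrib_left sum_subtractf algebra_simps)
    also have "\<dots> = 2 * \<delta>\<^sup>2 * (\<Sum>n\<le>m. c n m * (real k * lam * \<mu> n t - real n * \<mu> (n - 1) t))"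
      by (simp only: 3 sum_distrib_left mult.left_commute)
    also have "\<dots> = 2 * \<delta>\<^sup>2 * lam *
        (real k * p_hat M Nk G m t - (\<Sum>j=1..min m k. p_hat M Nk G (m - j) t))"
      unfolding p_hat[OF t] c_def ppok_prob_generator[OF assms(2), where \<mu> = "\<lambda>n. \<mu> n t"] by (rule mult.assoc[symmetric])
    finally show "(\<Sum>n\<le>m. c n m * \<mu>'' n t) - 2 * \<delta> * \<gamma> * (\<Sum>n\<le>m. c n m * \<mu>' n t)
        = 2 * \<delta>\<^sup>2 * lam *
        (real k * p_hat M Nk G m t - (\<Sum>j=1..min m k. p_hat M Nk G (m - j) t))" .
  qed
qed

end
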